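(* Let $L$ be a cyclic Galois extension of $K$ of odd degree $n=2m+1$ and suppose that $\sigma$ generates the Galois group of $L$ over $K$. For $1\le i\le m$ let $A^i=\{f_{b,\sigma^i}: b\in L\}\subseteq\operatorname{Alt}(L)$. Then for any integer $k$ satisfying $1\le k\le m$, all non-zero elements of the $nk$-dimensional subspace $$A^1\oplus\cdots\oplus A^k$$ of $\operatorname{Alt}(L)$ have rank at least $n-2k+1$.
   Context: $L$ is regarded as an $n$-dimensional vector space over $K$. $\operatorname{Alt}(L)$ is the $K$-vector space of all alternating $K$-bilinear forms $L\times L\to K$ (bilinear $f$ with $f(x,x)=0$ for all $x$). $\operatorname{Tr}:L\to K$ is the trace, $\operatorname{Tr}(x)=\sum_{\tau\in G}\tau(x)$, where $G$ is the Galois group of $L$ over $K$. For $b\in L$ and a non-identity $\tau\in G$, $f_{b,\tau}\in\operatorname{Alt}(L)$ is the form $f_{b,\tau}(x,y)=\operatorname{Tr}\big(b(x\tau(y)-\tau(x)y)\big)$. The rank of an alternating form $f$ is $n-\dim_K R$, where $R=\{x\in L: f(x,y)=0 \text{ for all } y\in L\}$ is its radical. *)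

theory Defs
  imports
    Complex_Main
    "HOL-Algebra.Generated_Groups"
    "HOL-Library.Function_Algebras"
    "HOL-Library.Set_Algebras"
begin

text \<open>
  A field extension \<open>L/K\<close> is given by two field types \<open>'k\<close> (for \<open>K\<close>) and \<open>'l\<close> (for \<open>L\<close>) and an
  embedding \<open>\<iota>\<close> identifying \<open>K\<close> with the subfield \<open>range \<iota>\<close> of \<open>L\<close>.
\<close>

definition field_embedding :: "('k::field \<Rightarrow> 'l::field) \<Rightarrow> bool" where
  "field_embedding \<iota> \<longleftrightarrow> \<iota> 1 = 1 \<and> (\<forall>a b. \<iota> (a + b) = \<iota> a + \<iota> b) \<and> (\<forall>a b. \<iota> (a * b) = \<iota> a * \<iota> b)"

definition ext_scale :: "('k::field \<Rightarrow> 'l::field) \<Rightarrow> 'k \<Rightarrow> 'l \<Rightarrow> 'l" where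
  "ext_scale \<iota> c x = \<iota> c * x"

lemma vector_space_ext_scale:
  assumes "field_embedding \<iota>"
  shows "vector_space (ext_scale \<iota>)"
  using assms by unfold_locales (auto simp: field_embedding_def ext_scale_def algebra_simps)

definition extension_degree :: "('k::field \<Rightarrow> 'l::field) \<Rightarrow> nat" where
  "extension_degree \<iota> = vector_space.dim (ext_scale \<iota>) UNIV"

definition galois_group :: "('k::field \<Rightarrow> 'l::field) \<Rightarrow> ('l \<Rightarrow> 'l) monoid" where
  "galois_group \<iota> =
    \<lparr>carrier = {\<tau>. bij \<tau> \<and> (\<forall>x y. \<tau> (x + y) = \<tau> x + \<tau> y) \<and> (\<forall>x y. \<tau> (x * y) = \<tau> x * \<tau> y) \<and>
                    (\<forall>c. \<tau> (\<iota> c) = \<iota> c)},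
     mult = (\<circ>),
     one = id\<rparr>"

lemma group_galois_group: "group (galois_group \<iota>)"
proof (rule groupI)
  fix \<tau> assume t: "\<tau> \<in> carrier (galois_group \<iota>)"
  then have b: "bij \<tau>"
    by (simp add: galois_group_def)
  have eq: "the_inv \<tau> x = y \<longleftrightarrow> x = \<tau> y" for x y
    using b by (metis bij_betw_def f_the_inv_into_f_bij_betw UNIV_I the_inv_f_f)
  have "the_inv \<tau> \<in> carrier (galois_group \<iota>)"
    using t b by (auto simp: galois_group_def eq bij_betw_the_inv_into f_the_inv_into_f_bij_betw)
  moreover have "the_inv \<tau> \<circ> \<tau> = id"
    by (auto simp: eq)
  ultimately show "\<exists>\<rho>\<in>carrier (galois_group \<iota>). \<rho> \<otimes>\<^bsub>galois_group \<iota>\<^esub> \<tau> = \<one>\<^bsub>galois_group \<iota>\<^esub>"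
    by (auto simp: galois_group_def)
qed (auto simp: galois_group_def bij_comp)

text \<open>Galois means: of finite degree, and the fixed field of the automorphism group is \<open>K\<close>.\<close>

definition galois_extension :: "('k::field \<Rightarrow> 'l::field) \<Rightarrow> bool" where
  "galois_extension \<iota> \<longleftrightarrow>
     field_embedding \<iota> \<and>
     (\<exists>B. finite_dimensional_vector_space (ext_scale \<iota>) B) \<and>
     {x. \<forall>\<tau>\<in>carrier (galois_group \<iota>). \<tau> x = x} = range \<iota>"

text \<open>
  The sum of the conjugates of \<open>x\<close> lies in \<open>range \<iota>\<close>; pulling it back along \<open>\<iota>\<close> gives the trace
  as a map into \<open>K\<close>.
\<close>

definition ext_trace :: "('k::field \<Rightarrow> 'l::field) \<Rightarrow> 'l \<Rightarrow> 'k" where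
  "ext_trace \<iota> x = the_inv \<iota> (\<Sum>\<tau>\<in>carrier (galois_group \<iota>). \<tau> x)"

lemma field_embedding_inj:
  assumes "field_embedding \<iota>"
  shows "inj \<iota>"
proof (rule injI)
  fix a b assume eq: "\<iota> a = \<iota> b"
  show "a = b"
  proof (rule ccontr)
    assume "a \<noteq> b"
    then have "a = (a - b) + b" "(a - b) * inverse (a - b) = 1"
      by simp_all
    then have "\<iota> a = \<iota> (a - b) + \<iota> b" "\<iota> (a - b) * \<iota> (inverse (a - b)) = 1"
      using assms unfolding field_embedding_def by metis+
    with eq show False
      by simp
  qed
qed

lemma embed_ext_trace:
  fixes \<iota> :: "'k::field \<Rightarrow> 'l::field"
  assumes "galois_extension \<iota>"
  shows "\<iota> (ext_trace \<iota> x) = (\<Sum>\<tau>\<in>carrier (galois_group \<iota>). \<tau> x)"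
proof -
  interpret group "galois_group \<iota>"
    by (rule group_galois_group)
  let ?G = "carrier (galois_group \<iota>)"
  have fixed: "\<rho> (\<Sum>\<tau>\<in>?G. \<tau> x) = (\<Sum>\<tau>\<in>?G. \<tau> x)" if r: "\<rho> \<in> ?G" for \<rho>
  proof -
    have add: "\<rho> (u + v) = \<rho> u + \<rho> v" for u v
      using r by (simp add: galois_group_def)
    then have "\<rho> 0 = 0"
      by (metis add_cancel_right_right)
    then have "\<rho> (\<Sum>\<tau>\<in>F. \<tau> x) = (\<Sum>\<tau>\<in>F. \<rho> (\<tau> x))" for F :: "('l \<Rightarrow> 'l) set"
      by (induction F rule: infinite_finite_induct) (auto simp: add)
    then have "\<rho> (\<Sum>\<tau>\<in>?G. \<tau> x) = (\<Sum>\<tau>\<in>?G. (\<rho> \<otimes>\<^bsub>galois_group \<iota>\<^esub> \<tau>) x)"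
      by (simp add: galois_group_def)
    also have "\<dots> = (\<Sum>\<tau>\<in>?G. \<tau> x)"
      using sum.reindex[OF inj_on_cmult[OF r], of "\<lambda>\<tau>. \<tau> x"] surj_const_mult[OF r]
      by (simp add: o_def)
    finally show ?thesis .
  qed
  then have "(\<Sum>\<tau>\<in>?G. \<tau> x) \<in> range \<iota>"
    using assms by (auto simp: galois_extension_def)
  then show ?thesis
    using assms unfolding ext_trace_def
    by (auto intro!: f_the_inv_into_f field_embedding_inj simp: galois_extension_def)
qed

text \<open>Forms \<open>L \<times> L \<rightarrow> K\<close> are curried; they are added pointwise.\<close>

definition form_scale :: "'k::field \<Rightarrow> ('l \<Rightarrow> 'l \<Rightarrow> 'k) \<Rightarrow> ('l \<Rightarrow> 'l \<Rightarrow> 'k)" where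
  "form_scale c f = (\<lambda>x y. c * f x y)"

lemma vector_space_form_scale: "vector_space form_scale"
  by unfold_locales (auto simp: form_scale_def fun_eq_iff algebra_simps)

definition Alt :: "('k::field \<Rightarrow> 'l::field) \<Rightarrow> ('l \<Rightarrow> 'l \<Rightarrow> 'k) set" where
  "Alt \<iota> = {f. (\<forall>y. Vector_Spaces.linear (ext_scale \<iota>) (*) (\<lambda>x. f x y)) \<and>
               (\<forall>x. Vector_Spaces.linear (ext_scale \<iota>) (*) (f x)) \<and>
               (\<forall>x. f x x = 0)}"

definition radical :: "('l \<Rightarrow> 'l \<Rightarrow> 'k::field) \<Rightarrow> 'l set" where
  "radical f = {x. \<forall>y. f x y = 0}"

definition form_rank :: "('k::field \<Rightarrow> 'l::field) \<Rightarrow> ('l \<Rightarrow> 'l \<Rightarrow> 'k) \<Rightarrow> nat" where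
  "form_rank \<iota> f = extension_degree \<iota> - vector_space.dim (ext_scale \<iota>) (radical f)"

definition trace_form :: "('k::field \<Rightarrow> 'l::field) \<Rightarrow> 'l \<Rightarrow> ('l \<Rightarrow> 'l) \<Rightarrow> ('l \<Rightarrow> 'l \<Rightarrow> 'k)" where
  "trace_form \<iota> b \<tau> = (\<lambda>x y. ext_trace \<iota> (b * (x * \<tau> y - \<tau> x * y)))"

definition trace_forms :: "('k::field \<Rightarrow> 'l::field) \<Rightarrow> ('l \<Rightarrow> 'l) \<Rightarrow> ('l \<Rightarrow> 'l \<Rightarrow> 'k) set" where
  "trace_forms \<iota> \<tau> = range (\<lambda>b. trace_form \<iota> b \<tau>)"

text \<open>
  The sum of the family \<open>A\<close> of spaces of forms is direct. The sum itself is \<open>\<Sum>i\<in>I. A i\<close>, a sum of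
  sets in the sense of \<open>Set_Algebras\<close>.
\<close>

definition direct_family :: "'i set \<Rightarrow> ('i \<Rightarrow> ('l \<Rightarrow> 'l \<Rightarrow> 'k::field) set) \<Rightarrow> bool" where
  "direct_family I A \<longleftrightarrow>
     (\<forall>i\<in>I. module.subspace form_scale (A i)) \<and>
     (\<forall>g. (\<forall>i\<in>I. g i \<in> A i) \<and> (\<Sum>i\<in>I. g i) = 0 \<longrightarrow> (\<forall>i\<in>I. g i = 0))"

end

theory Submission
  imports Defs
begin

text \<open>
  Moving every automorphism onto the first argument, a sum \<open>f\<close> of trace forms with parameters
  \<open>b\<^sub>1, \<dots>, b\<^sub>k\<close> becomes \<open>f x y = Tr (P x \<cdot> \<sigma>\<^sup>k y)\<close>, where \<open>P = \<Sum>j\<le>2k. a j \<sigma>\<^sup>j\<close>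
  has coefficients \<open>\<sigma>\<^sup>j (b (k - j))\<close> for \<open>j < k\<close> and \<open>- \<sigma>\<^sup>k (b (j - k))\<close> for \<open>j > k\<close>.
  As the trace is nondegenerate, the radical of \<open>f\<close> is the kernel of \<open>P\<close>. Like an ordinary
  polynomial, a nonzero polynomial in \<open>\<sigma>\<close> of degree at most \<open>d\<close> has a kernel of dimension at most
  \<open>d\<close> over \<open>K\<close>. Since \<open>2k < n\<close>, the form determines its parameters, which gives directness and the
  dimension; and the rank is at least \<open>n - 2k\<close>. That number is odd, whereas alternating forms have
  even rank in every characteristic, so one more is gained.
\<close>

section \<open>Alternating forms have even rank\<close>

context finite_dimensional_vector_space
begin

text \<open>Induction on \<open>dim W\<close>, splitting off a hyperbolic plane: if \<open>f\<close>
  is nonzero on \<open>W\<close>, a pair \<open>u\<close>, \<open>v\<close> with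
  \<open>f u v = 1\<close> has an orthogonal complement in \<open>W\<close> of dimension two less
  and with the same radical. Adding the dimensions instead of subtracting them records the parity of
  the rank, and a general \<open>W\<close> lets the induction descend.\<close>

lemma even_dim_plus_dim_radical:
  fixes f :: "'b \<Rightarrow> 'b \<Rightarrow> 'a"
  assumes W: "subspace W"
    and l1: "\<And>y. Vector_Spaces.linear scale (*) (\<lambda>x. f x y)"
    and l2: "\<And>x. Vector_Spaces.linear scale (*) (f x)"
    and alt: "\<And>x. f x x = 0"
  shows "even (dim W + dim {x \<in> W. \<forall>y\<in>W. f x y = 0})"
  using W
proof (induction "dim W" arbitrary: W rule: less_induct)
  case less
  have add1: "f (x + x') y = f x y + f x' y" and sc1: "f (scale c x) y = c * f x y"
    and add2: "f x (y + y') = f x y + f x y'" and sc2: "f x (scale c y) = c * f x y"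
    for x x' y y' c
    using l1 l2 by (auto simp: Vector_Spaces.linear_iff)
  have z2: "f x 0 = 0" for x
    using sc2[of x 0 0] by auto
  have skew: "f y x = - f x y" for x y
  proof -
    have "f x x + f x y + (f y x + f y y) = 0"
      using alt[of "x + y"] unfolding add1 add2 by (simp add: ac_simps)
    then show ?thesis by (simp add: alt eq_neg_iff_add_eq_0 add.commute)
  qed
  show ?case
  proof (cases "\<forall>x\<in>W. \<forall>y\<in>W. f x y = 0")
    case True
    then have "{x \<in> W. \<forall>y\<in>W. f x y = 0} = W" by auto
    then show ?thesis by simp
  next
    case False
    then obtain u v' where u: "u \<in> W" and v': "v' \<in> W" "f u v' \<noteq> 0" by blast
    define v where "v = scale (1 / f u v') v'"
    have v: "v \<in> W" "f u v = 1"
      using v' less.prems by (simp_all add: v_def subspace_scale sc2)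
    have vu: "f v u = -1"
      using skew[of v u] v by simp
    \<comment> \<open>The orthogonal complement of the plane spanned by \<open>u\<close> and
      \<open>v\<close>.\<close>
    define W' where "W' = {x \<in> W. f u x = 0 \<and> f v x = 0}"
    have sub: "subspace W'"
      using less.prems by (auto simp: W'_def subspace_def add2 sc2 z2)
    have nv: "v \<notin> span W'"
      using sub v by (auto simp: span_eq_iff[THEN iffD2] W'_def)
    \<comment> \<open>Since \<open>f v\<close> vanishes on \<open>v\<close> and on \<open>W'\<close>
      but takes the value -1 at \<open>u\<close>, it separates \<open>u\<close> from their
      span.\<close>
    have "f v x = 0" if "x \<in> span (insert v W')" for x
      using that
    proof (induction rule: span_induct)
      case base
      show ?case by (auto simp: subspace_def add2 sc2 z2)
    next
      case (step x)
      then show ?case by (auto simp: W'_def alt)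
    qed
    then have nu: "u \<notin> span (insert v W')"
      using vu by auto
    \<comment> \<open>The coefficients of the projection onto the plane are read off from
      \<open>f u v = 1\<close> and \<open>f v u = -1\<close>.\<close>
    have decomp: "\<exists>w\<in>W'. x = w + (scale (- f v x) u + scale (f u x) v)" if "x \<in> W" for x
    proof (intro bexI)
      let ?w = "x + (scale (f v x) u + scale (- f u x) v)"
      have "f u ?w = 0" "f v ?w = 0"
        by (simp_all only: add2 sc2 alt v vu) simp_all
      moreover have "?w \<in> W"
        using that u v less.prems by (intro subspace_add subspace_scale)
      ultimately show "?w \<in> W'" by (simp add: W'_def)
      show "x = ?w + (scale (- f v x) u + scale (f u x) v)" by simp
    qed
    have "span (insert u (insert v W')) = W"
    proof
      show "span (insert u (insert v W')) \<subseteq> W"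
        using u v less.prems by (intro span_minimal) (auto simp: W'_def)
      show "W \<subseteq> span (insert u (insert v W'))"
      proof
        fix x assume "x \<in> W"
        then obtain w where "w \<in> W'" "x = w + (scale (- f v x) u + scale (f u x) v)"
          using decomp by blast
        then show "x \<in> span (insert u (insert v W'))"
          by (metis span_add span_scale span_base insertCI)
      qed
    qed
    then have dim: "dim W = dim W' + 2"
      using nu nv by (metis dim_span dim_insert add.assoc one_add_one)
    \<comment> \<open>A vector of the larger radical is orthogonal to \<open>u\<close> and
      \<open>v\<close>, so it lies in \<open>W'\<close>; conversely, a vector of \<open>W'\<close>
      orthogonal to \<open>W'\<close> is orthogonal to the plane as well, hence to all of
      \<open>W\<close>.\<close>
    have "{x \<in> W. \<forall>y\<in>W. f x y = 0} = {x \<in> W'. \<forall>y\<in>W'. f x y = 0}" (is "?R = ?R'")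
    proof
      show "?R \<subseteq> ?R'"
      proof
        fix x assume "x \<in> ?R"
        then show "x \<in> ?R'"
          using u v skew[of x u] skew[of x v] by (auto simp: W'_def)
      qed
      show "?R' \<subseteq> ?R"
      proof
        fix x assume x: "x \<in> ?R'"
        then have xu: "f x u = 0" "f x v = 0"
          using skew[of x u] skew[of x v] by (auto simp: W'_def)
        have "f x y = 0" if y: "y \<in> W" for y
        proof -
          obtain w where w: "w \<in> W'" "y = w + (scale (- f v y) u + scale (f u y) v)"
            using decomp[OF y] by blast
          have "f x y = f x (w + (scale (- f v y) u + scale (f u y) v))"
            by (rule arg_cong[OF w(2)])
          also have "\<dots> = 0"
            unfolding add2 sc2 using w(1) x xu by simp
          finally show ?thesis .
        qed
        then show "x \<in> ?R" using x by (auto simp: W'_def)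
      qed
    qed
    then show ?thesis
      using less.hyps[of W'] dim sub by simp
  qed
qed

end

section \<open>Skew polynomials in a generator of the Galois group\<close>

lemma sum_fun_apply2: "(\<Sum>i\<in>I. f i) x y = (\<Sum>i\<in>I. f i x y)"
  for f :: "'i \<Rightarrow> 'a \<Rightarrow> 'b \<Rightarrow> 'c::comm_monoid_add"
  by (induction I rule: infinite_finite_induct) auto

text \<open>Abel summation with tail sums. For \<open>z j\<close> = \<sigma>^j y the differences are
  \<sigma>^j (\<sigma> y - y), so this is right division by \<sigma> - 1 with the sum of the
  coefficients as remainder.\<close>

lemma summation_by_parts:
  fixes a z :: "nat \<Rightarrow> 'a::comm_ring_1"
  shows "(\<Sum>j\<le>d. a j * z j) =
    (\<Sum>j<d. (\<Sum>i\<in>{j<..d}. a i) * (z (Suc j) - z j)) + (\<Sum>i\<le>d. a i) * z 0"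
proof (induction d)
  case (Suc d)
  have "(\<Sum>i\<in>{j<..Suc d}. a i) = (\<Sum>i\<in>{j<..d}. a i) + a (Suc d)" if "j < Suc d" for j
  proof -
    have "{j<..Suc d} = insert (Suc d) {j<..d}" using that by auto
    then show ?thesis by simp
  qed
  then have "(\<Sum>j<Suc d. (\<Sum>i\<in>{j<..Suc d}. a i) * (z (Suc j) - z j)) =
      (\<Sum>j<Suc d. (\<Sum>i\<in>{j<..d}. a i) * (z (Suc j) - z j)) +
      a (Suc d) * (\<Sum>j<Suc d. z (Suc j) - z j)"
    by (simp only: sum_distrib_left sum.distrib[symmetric])
       (intro sum.cong refl, auto simp: algebra_simps)
  also have "(\<Sum>j<Suc d. z (Suc j) - z j) = z (Suc d) - z 0"
    by (rule sum_lessThan_telescope)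
  finally show ?case
    using Suc by (simp add: algebra_simps)
qed simp

text \<open>Pairs the indices \<open>k - i\<close> and \<open>k + i\<close>, the two places where
  the parameter \<open>b i\<close> will enter the polynomial that describes the radical.\<close>

lemma sum_atMost_centered:
  fixes g :: "nat \<Rightarrow> 'a::comm_monoid_add"
  shows "(\<Sum>j\<le>2 * k. g j) = g k + (\<Sum>i=1..k. g (k - i) + g (k + i))"
proof -
  have "(\<Sum>j=k - r..k + r. g j) = g k + (\<Sum>i=1..r. g (k - i) + g (k + i))" if "r \<le> k" for r
    using that
  proof (induction r)
    case (Suc r)
    have "{k - Suc r..k + Suc r} = insert (k - Suc r) (insert (k + Suc r) {k - r..k + r})"
      using Suc.prems by auto
    moreover have "k - Suc r \<notin> {k - r..k + r}" "k + Suc r \<notin> {k - r..k + r}" "k - Suc r \<noteq> k + Suc r"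
      using Suc.prems by auto
    ultimately show ?case
      using Suc by (simp add: ac_simps)
  qed simp
  from this[of k] show ?thesis
    by (simp add: atMost_atLeast0 mult_2)
qed

text \<open>Fixing a basis \<open>E\<close> makes the degree of the extension available as
  \<open>card E\<close>.\<close>

locale cyclic_extension = V: finite_dimensional_vector_space "ext_scale \<iota>" E
  for \<iota> :: "'k::field \<Rightarrow> 'l::field" and E +
  fixes \<sigma> :: "'l \<Rightarrow> 'l"
  assumes galois: "galois_extension \<iota>"
    and sigma: "\<sigma> \<in> carrier (galois_group \<iota>)"
    and generates: "generate (galois_group \<iota>) {\<sigma>} = carrier (galois_group \<iota>)"
begin

section \<open>Powers of the generator as automorphisms over K\<close>

lemma embedding: "\<iota> 1 = 1" "\<iota> (a + b) = \<iota> a + \<iota> b" "\<iota> (a * b) = \<iota> a * \<iota> b"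
  using galois by (auto simp: galois_extension_def field_embedding_def)

lemma embedding_inj: "\<iota> a = \<iota> b \<longleftrightarrow> a = b"
  using galois field_embedding_inj[of \<iota>] by (auto simp: galois_extension_def inj_def)

lemma embedding_0: "\<iota> 0 = 0"
  using embedding(2)[of 0 0] by (metis add_cancel_right_right)

lemma sigma_add: "(\<sigma> ^^ j) (x + y) = (\<sigma> ^^ j) x + (\<sigma> ^^ j) y"
  and sigma_mult: "(\<sigma> ^^ j) (x * y) = (\<sigma> ^^ j) x * (\<sigma> ^^ j) y"
  and sigma_embedding: "(\<sigma> ^^ j) (\<iota> c) = \<iota> c"
  and bij_sigma: "bij (\<sigma> ^^ j)"
  using sigma by (induction j) (auto simp: galois_group_def bij_comp bij_id[unfolded id_def])

lemma sigma_0 [simp]: "(\<sigma> ^^ j) 0 = 0"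
  using sigma_add[of j 0 0] by (metis add_cancel_right_right)

lemma sigma_1 [simp]: "(\<sigma> ^^ j) 1 = 1"
  using sigma_embedding[of j 1] by (simp add: embedding)

lemma sigma_minus: "(\<sigma> ^^ j) (- x) = - (\<sigma> ^^ j) x"
  using sigma_add[of j x "- x"] by (simp add: eq_neg_iff_add_eq_0 add.commute)

lemma sigma_diff: "(\<sigma> ^^ j) (x - y) = (\<sigma> ^^ j) x - (\<sigma> ^^ j) y"
  using sigma_add[of j x "- y"] by (simp add: sigma_minus)

lemma sigma_sum: "(\<sigma> ^^ j) (\<Sum>i\<in>I. f i) = (\<Sum>i\<in>I. (\<sigma> ^^ j) (f i))"
  by (induction I rule: infinite_finite_induct) (auto simp: sigma_add)

lemma sigma_inj: "(\<sigma> ^^ j) x = (\<sigma> ^^ j) y \<longleftrightarrow> x = y"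
  using bij_sigma[of j] by (auto simp: bij_def inj_def)

lemma sigma_eq_0_iff: "(\<sigma> ^^ j) x = 0 \<longleftrightarrow> x = 0"
  using sigma_inj[of j x 0] by simp

lemma sigma_Suc_inner: "(\<sigma> ^^ j) (\<sigma> x) = (\<sigma> ^^ Suc j) x"
  by (simp add: funpow_swap1)

lemma sigma_compose: "(\<sigma> ^^ i) ((\<sigma> ^^ j) x) = (\<sigma> ^^ (i + j)) x"
  by (simp add: funpow_add)

text \<open>An element fixed by the generator is fixed by the whole group, hence lies in K by the
  Galois property.\<close>

lemma sigma_fixed: "\<sigma> x = x \<Longrightarrow> x \<in> range \<iota>"
proof -
  assume x: "\<sigma> x = x"
  interpret group "galois_group \<iota>" by (rule group_galois_group)
  have "\<tau> x = x" if "\<tau> \<in> generate (galois_group \<iota>) {\<sigma>}" for \<tau>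
    using that
  proof (induction rule: generate.induct)
    case (inv h)
    then have "inv\<^bsub>galois_group \<iota>\<^esub> \<sigma> \<circ> \<sigma> = id"
      using l_inv[OF sigma] by (simp add: galois_group_def)
    then show ?case
      using x inv by (metis comp_apply id_apply singletonD)
  qed (auto simp: galois_group_def x)
  then show ?thesis
    using galois generates by (auto simp: galois_extension_def)
qed

text \<open>After rescaling so that 1 is a root, the polynomial is right divisible by \<open>\<sigma> - 1\<close>, whose
  kernel is only \<open>K\<close>.\<close>

lemma card_independent_roots_le:
  assumes "V.independent B" "\<And>x. x \<in> B \<Longrightarrow> (\<Sum>j\<le>d. a j * (\<sigma> ^^ j) x) = 0"
    and "\<exists>j\<le>d. a j \<noteq> 0"
  shows "card B \<le> d"
  using assms
proof (induction d arbitrary: a B)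
  case 0
  have "B = {}"
  proof (rule ccontr)
    assume "B \<noteq> {}"
    then obtain x where "x \<in> B" by blast
    then show False using 0 V.dependent_zero[of B] by auto
  qed
  then show ?case by simp
next
  case (Suc d)
  have fin: "finite B" using Suc.prems by (simp add: V.finiteI_independent)
  show ?case
  proof (cases "B = {}")
    case False
    then obtain c where c: "c \<in> B" by blast
    define B' where "B' = B - {c}"
    have c0: "c \<noteq> 0" using c Suc.prems(1) V.dependent_zero by blast
    have ind': "V.independent B'" and nc: "c \<notin> V.span B'"
      using Suc.prems(1) c by (auto simp: B'_def V.dependent_def intro: V.span_mono[THEN subsetD, rotated])
    \<comment> \<open>Coefficients of the polynomial composed with multiplication by
      \<open>c\<close>: the root \<open>c\<close> becomes the root 1, which says that the
      coefficients sum to 0.\<close>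
    define a' where "a' j = a j * (\<sigma> ^^ j) c" for j
    \<comment> \<open>The quotient on division by \<sigma> - 1. The map \<open>\<psi>\<close> below,
      x \<mapsto> (\<sigma> - 1)(x / c), carries roots of the original polynomial to roots of
      \<open>q\<close>.\<close>
    define q where "q j = (\<Sum>i\<in>{j<..Suc d}. a' i)" for j
    define \<psi> where "\<psi> x = \<sigma> (x / c) - x / c" for x
    have div: "(\<Sum>j\<le>Suc d. a' j * (\<sigma> ^^ j) (x / c)) = (\<Sum>j\<le>Suc d. a j * (\<sigma> ^^ j) x)" for x
    proof (intro sum.cong refl)
      fix j
      have "(\<sigma> ^^ j) c * (\<sigma> ^^ j) (x / c) = (\<sigma> ^^ j) x"
        using c0 by (simp add: sigma_mult[symmetric])
      then show "a' j * (\<sigma> ^^ j) (x / c) = a j * (\<sigma> ^^ j) x"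
        by (simp add: a'_def mult.assoc)
    qed
    have sum_a': "(\<Sum>j\<le>Suc d. a' j) = 0"
      using div[of c] Suc.prems(2)[OF c] c0 by (simp add: sigma_1)
    have roots: "(\<Sum>j\<le>d. q j * (\<sigma> ^^ j) y) = 0" if y: "y \<in> \<psi> ` B'" for y
    proof -
      obtain x where x: "x \<in> B" "y = \<psi> x" using y by (auto simp: B'_def)
      have "0 = (\<Sum>j\<le>Suc d. a' j * (\<sigma> ^^ j) (x / c))"
        using div[of x] Suc.prems(2)[OF x(1)] by simp
      also have "\<dots> = (\<Sum>j<Suc d. q j * ((\<sigma> ^^ Suc j) (x / c) - (\<sigma> ^^ j) (x / c)))"
        using summation_by_parts[of a' "\<lambda>j. (\<sigma> ^^ j) (x / c)" "Suc d"] sum_a'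
        by (simp only: q_def) simp
      also have "\<dots> = (\<Sum>j\<le>d. q j * (\<sigma> ^^ j) y)"
        unfolding lessThan_Suc_atMost x(2) \<psi>_def sigma_diff sigma_Suc_inner ..
      finally show ?thesis by simp
    qed
    \<comment> \<open>The differences of consecutive tails return \<open>a'\<close> at positive
      indices, and the vanishing sum returns \<open>a' 0\<close>; so \<open>q = 0\<close> would
      force \<open>a = 0\<close>.\<close>
    have q_nz: "\<exists>j\<le>d. q j \<noteq> 0"
    proof (rule ccontr)
      assume "\<not> ?thesis"
      then have q0: "q j = 0" if "j \<le> d" for j using that by blast
      have step: "q j = a' (Suc j) + q (Suc j)" if "j \<le> d" for j
      proof -
        have "{j<..Suc d} = insert (Suc j) {Suc j<..Suc d}" using that by auto
        then show ?thesis by (simp add: q_def)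
      qed
      have "a' (Suc j) = 0" if "j \<le> d" for j
      proof (cases "j = d")
        case True
        then show ?thesis using step[of d] q0[of d] by (simp add: q_def)
      next
        case False
        then show ?thesis using step[of j] q0[of j] q0[of "Suc j"] that by simp
      qed
      then have "a' j = 0" if "j \<le> Suc d" "j \<noteq> 0" for j
        using that by (cases j) auto
      moreover from this have "a' 0 = 0"
        using sum_a' by (simp add: sum.atMost_Suc_shift del: sum.atMost_Suc)
      ultimately have "a j = 0" if "j \<le> Suc d" for j
        using that c0 by (cases "j = 0") (auto simp: a'_def sigma_eq_0_iff)
      then show False using Suc.prems(3) by blast
    qed
    have lin: "Vector_Spaces.linear (ext_scale \<iota>) (ext_scale \<iota>) \<psi>"
    proof -
      have "\<psi> (x + y) = \<psi> x + \<psi> y" for x y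
        using sigma_add[of 1 "x / c" "y / c"] by (simp add: \<psi>_def add_divide_distrib)
      moreover have "\<psi> (\<iota> r * x) = \<iota> r * \<psi> x" for r x
        using sigma_mult[of 1 "\<iota> r" "x / c"] sigma_embedding[of 1 r]
        by (simp add: \<psi>_def right_diff_distrib)
      ultimately show ?thesis
        by (simp add: Vector_Spaces.linear_iff V.vector_space_axioms ext_scale_def)
    qed
    interpret \<psi>: Vector_Spaces.linear "ext_scale \<iota>" "ext_scale \<iota>" \<psi> by (rule lin)
    \<comment> \<open>If \<open>\<psi> x = 0\<close> then \<open>x / c\<close> is in K, so
      \<open>x\<close> is a K-multiple of \<open>c\<close>; as \<open>c\<close> is outside the span
      of \<open>B'\<close>, the multiple is 0.\<close>
    have "x = 0" if x: "x \<in> V.span B'" "\<psi> x = 0" for x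
    proof -
      obtain r where r: "x / c = \<iota> r"
        using sigma_fixed[of "x / c"] x(2) by (auto simp: \<psi>_def)
      have xc: "x = ext_scale \<iota> r c"
        using r c0 by (simp add: ext_scale_def field_simps)
      show ?thesis
      proof (cases "r = 0")
        case False
        have "ext_scale \<iota> (1 / r) x = c"
          using False by (simp add: xc)
        then show ?thesis
          using V.span_scale[OF x(1), of "1 / r"] nc by simp
      qed (simp add: xc)
    qed
    then have inj: "inj_on \<psi> (V.span B')"
      by (simp add: \<psi>.inj_on_iff_eq_0)
    have "card (\<psi> ` B') \<le> d"
      by (rule Suc.IH[OF _ roots q_nz]) (simp add: \<psi>.independent_injective_image[OF ind' inj])
    moreover have "card (\<psi> ` B') = card B'"
      by (intro card_image inj_on_subset[OF inj] V.span_superset)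
    ultimately show ?thesis
      using c fin by (simp add: B'_def)
  qed simp
qed

section \<open>Independence of powers and finite order of the generator\<close>

text \<open>Built one root at a time: if \<open>P\<close> annihilates \<open>B\<close>, then
  (\<sigma> - e) P still does, and e = \<sigma>(P c) / P c makes it annihilate \<open>c\<close> too.
  The leading coefficient stays 1.\<close>

lemma annihilating_polynomial:
  assumes "finite B"
  shows "\<exists>a. a (card B) = 1 \<and> (\<forall>x\<in>B. (\<Sum>j\<le>card B. a j * (\<sigma> ^^ j) x) = 0)"
  using assms
proof (induction B)
  case empty
  show ?case by (auto intro: exI[of _ "\<lambda>_. 1"])
next
  case (insert c B)
  then obtain a where a: "a (card B) = 1" "\<forall>x\<in>B. (\<Sum>j\<le>card B. a j * (\<sigma> ^^ j) x) = 0"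
    by blast
  define P where "P x = (\<Sum>j\<le>card B. a j * (\<sigma> ^^ j) x)" for x
  \<comment> \<open>If \<open>P c = 0\<close>, then \<open>c\<close> is already a root and the value
    0 serves.\<close>
  define e where "e = (if P c = 0 then 0 else \<sigma> (P c) / P c)"
  \<comment> \<open>The coefficients of (\<sigma> - e) P; the guards cut \<open>a\<close> off
    outside the degrees from 0 to \<open>card B\<close>, where its values are arbitrary.\<close>
  define a' where "a' j = (if j = 0 then 0 else \<sigma> (a (j - 1))) - (if j \<le> card B then e * a j else 0)"
    for j
  have P': "(\<Sum>j\<le>Suc (card B). a' j * (\<sigma> ^^ j) x) = \<sigma> (P x) - e * P x" for x
  proof -
    have "(\<Sum>j\<le>Suc (card B). a' j * (\<sigma> ^^ j) x) =
        (\<Sum>j\<le>Suc (card B). (if j = 0 then 0 else \<sigma> (a (j - 1))) * (\<sigma> ^^ j) x) -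
        (\<Sum>j\<le>Suc (card B). (if j \<le> card B then e * a j else 0) * (\<sigma> ^^ j) x)"
      by (simp only: a'_def left_diff_distrib sum_subtractf)
    also have "(\<Sum>j\<le>Suc (card B). (if j \<le> card B then e * a j else 0) * (\<sigma> ^^ j) x) = e * P x"
      by (simp add: P_def sum_distrib_left mult.assoc)
    also have "(\<Sum>j\<le>Suc (card B). (if j = 0 then 0 else \<sigma> (a (j - 1))) * (\<sigma> ^^ j) x) = \<sigma> (P x)"
    proof -
      have "\<sigma> (P x) = (\<Sum>j\<le>card B. \<sigma> (a j) * \<sigma> ((\<sigma> ^^ j) x))"
        using sigma_sum[of 1 "\<lambda>j. a j * (\<sigma> ^^ j) x" "{..card B}"] sigma_mult[of 1]
        unfolding P_def by simp
      then show ?thesis by (subst sum.atMost_Suc_shift) simp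
    qed
    finally show ?thesis .
  qed
  have "\<sigma> 0 = 0" using sigma_0[of 1] by simp
  then have "\<sigma> (P x) - e * P x = 0" if "x \<in> insert c B" for x
    using that a(2) by (auto simp: P_def[symmetric] e_def)
  moreover have "a' (Suc (card B)) = 1"
    using a(1) sigma_1[of 1] by (simp add: a'_def)
  ultimately show ?case
    using insert.hyps P' by (intro exI[of _ a']) simp
qed

lemma subspace_roots: "V.subspace {x. (\<Sum>j\<le>d. a j * (\<sigma> ^^ j) x) = 0}"
proof -
  have "(\<Sum>j\<le>d. a j * (\<sigma> ^^ j) (ext_scale \<iota> c x)) = \<iota> c * (\<Sum>j\<le>d. a j * (\<sigma> ^^ j) x)" for c x
    by (simp add: sum_distrib_left ext_scale_def sigma_mult sigma_embedding mult_ac)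
  then show ?thesis
    by (simp add: V.subspace_def sigma_add distrib_left sum.distrib)
qed

lemma dim_roots_le:
  assumes "\<exists>j\<le>d. a j \<noteq> 0"
  shows "V.dim {x. (\<Sum>j\<le>d. a j * (\<sigma> ^^ j) x) = 0} \<le> d"
proof -
  obtain B where "B \<subseteq> {x. (\<Sum>j\<le>d. a j * (\<sigma> ^^ j) x) = 0}" "V.independent B"
    "card B = V.dim {x. (\<Sum>j\<le>d. a j * (\<sigma> ^^ j) x) = 0}"
    by (rule V.basis_exists[of "{x. (\<Sum>j\<le>d. a j * (\<sigma> ^^ j) x) = 0}"])
  then show ?thesis
    using card_independent_roots_le[of B a d] assms by auto
qed

text \<open>Linear independence over L of the powers 1, \<sigma>, ..., \<sigma>^d for d < n: a
  nontrivial relation would have all of L, of dimension n, as its kernel.\<close>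

lemma coeffs_eq_0:
  assumes "\<And>x. (\<Sum>j\<le>d. a j * (\<sigma> ^^ j) x) = 0" "d < card E" "j \<le> d"
  shows "a j = 0"
proof (rule ccontr)
  assume "a j \<noteq> 0"
  then have "V.dim {x. (\<Sum>j\<le>d. a j * (\<sigma> ^^ j) x) = 0} \<le> d"
    using assms(3) by (intro dim_roots_le) auto
  then show False
    using assms(1,2) by simp
qed

text \<open>If \<open>\<sigma>\<^sup>n = - (\<Sum>j<n. a j \<sigma>\<^sup>j)\<close>, then multiplicativity and uniqueness of coefficients
  force \<open>\<sigma>\<^sup>j = \<sigma>\<^sup>n\<close> whenever \<open>a j \<noteq> 0\<close>.\<close>

lemma sigma_finite_order: "\<exists>N>0. N \<le> card E \<and> \<sigma> ^^ N = id"
proof -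
  let ?d = "card E"
  obtain a where a1: "a ?d = 1" and aE: "\<forall>x\<in>E. (\<Sum>j\<le>?d. a j * (\<sigma> ^^ j) x) = 0"
    using annihilating_polynomial[OF V.finite_Basis] by blast
  have "V.span E \<subseteq> {x. (\<Sum>j\<le>?d. a j * (\<sigma> ^^ j) x) = 0}"
    using aE by (intro V.span_minimal subspace_roots) auto
  then have P: "(\<Sum>j\<le>?d. a j * (\<sigma> ^^ j) x) = 0" for x
    by (auto simp: V.span_Basis)
  have split: "(\<Sum>j\<le>?d. g j) = (\<Sum>j<?d. g j) + g ?d" for g :: "nat \<Rightarrow> 'l"
    by (simp flip: lessThan_Suc_atMost)
  \<comment> \<open>Otherwise the relation evaluated at 1 reads 1 = 0.\<close>
  have "\<exists>j<?d. a j \<noteq> 0"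
  proof (rule ccontr)
    assume "\<not> ?thesis"
    then have "(\<Sum>j<?d. a j * (\<sigma> ^^ j) 1) = 0"
      by (intro sum.neutral) auto
    then show False
      using P[of 1] a1 by (simp add: split)
  qed
  then obtain j where j: "j < ?d" "a j \<noteq> 0" by blast
  have "(\<sigma> ^^ (?d - j)) x = x" for x
  proof -
    \<comment> \<open>Subtracting \<sigma>^d(x) times the relation at \<open>y\<close> from the
      relation at \<open>x * y\<close> cancels the top term. What is left has degree below d =
      \<open>card E\<close>, so its coefficients vanish.\<close>
    have "(\<Sum>i\<le>?d - 1. a i * ((\<sigma> ^^ i) x - (\<sigma> ^^ ?d) x) * (\<sigma> ^^ i) y) = 0" for y
    proof -
      have "(\<Sum>i\<le>?d - 1. a i * ((\<sigma> ^^ i) x - (\<sigma> ^^ ?d) x) * (\<sigma> ^^ i) y) =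
          (\<Sum>i<?d. a i * ((\<sigma> ^^ i) x - (\<sigma> ^^ ?d) x) * (\<sigma> ^^ i) y)"
        using j by (intro sum.cong) auto
      also have "\<dots> = (\<Sum>i\<le>?d. a i * ((\<sigma> ^^ i) x - (\<sigma> ^^ ?d) x) * (\<sigma> ^^ i) y)"
        by (simp add: split)
      also have "\<dots> = (\<Sum>i\<le>?d. a i * (\<sigma> ^^ i) (x * y)) -
          (\<sigma> ^^ ?d) x * (\<Sum>i\<le>?d. a i * (\<sigma> ^^ i) y)"
        by (simp add: sigma_mult algebra_simps sum_subtractf sum_distrib_left)
      finally show ?thesis by (simp add: P)
    qed
    from coeffs_eq_0[OF this, of j] j have "(\<sigma> ^^ j) x = (\<sigma> ^^ ?d) x"
      by simp
    also have "\<dots> = (\<sigma> ^^ j) ((\<sigma> ^^ (?d - j)) x)"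
      using j by (simp add: sigma_compose)
    finally show ?thesis by (simp add: sigma_inj)
  qed
  then show ?thesis
    using j by (intro exI[of _ "?d - j"]) auto
qed

text \<open>Here \<open>N\<close> is the order of \<sigma>, and the group consists of the powers
  \<sigma>^j with j < N. The bound \<open>N \<le> card E\<close> puts the trace within reach of
  \<open>coeffs_eq_0\<close>.\<close>

lemma trace_as_power_sum:
  obtains N where "0 < N" "N \<le> card E" "\<sigma> ^^ N = id"
    "\<And>x. \<iota> (ext_trace \<iota> x) = (\<Sum>j<N. (\<sigma> ^^ j) x)"
proof -
  define N where "N = (LEAST N. 0 < N \<and> \<sigma> ^^ N = id)"
  obtain M where M: "0 < M" "M \<le> card E" "\<sigma> ^^ M = id"
    using sigma_finite_order by blast
  have N: "0 < N" "\<sigma> ^^ N = id"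
    using LeastI[of "\<lambda>N. 0 < N \<and> \<sigma> ^^ N = id" M] M by (auto simp: N_def)
  have "N \<le> M"
    unfolding N_def using M by (intro Least_le) auto
  have distinct: "inj_on (\<lambda>j. \<sigma> ^^ j) {..<N}"
  proof (rule linorder_inj_onI)
    fix i j assume "i < j" "j \<in> {..<N}"
    have "\<sigma> ^^ (j - i) = id" if eq: "\<sigma> ^^ i = \<sigma> ^^ j"
    proof
      fix x
      have "(\<sigma> ^^ i) ((\<sigma> ^^ (j - i)) x) = (\<sigma> ^^ j) x"
        using \<open>i < j\<close> by (simp add: sigma_compose)
      also have "\<dots> = (\<sigma> ^^ i) x"
        by (simp add: eq)
      finally show "(\<sigma> ^^ (j - i)) x = id x" by (simp add: sigma_inj)
    qed
    moreover have "\<sigma> ^^ (j - i) \<noteq> id"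
      using not_less_Least[of "j - i" "\<lambda>N. 0 < N \<and> \<sigma> ^^ N = id"] \<open>i < j\<close> \<open>j \<in> {..<N}\<close>
      by (auto simp: N_def)
    ultimately show "\<sigma> ^^ i \<noteq> \<sigma> ^^ j" by blast
  qed auto
  have reduce: "\<sigma> ^^ j \<in> (\<lambda>j. \<sigma> ^^ j) ` {..<N}" for j
  proof -
    have "\<sigma> ^^ j = \<sigma> ^^ (j mod N)"
    proof
      fix x
      show "(\<sigma> ^^ j) x = (\<sigma> ^^ (j mod N)) x"
        using funpow_mod_eq[of N \<sigma> x j] N by simp
    qed
    then show ?thesis using N by auto
  qed
  interpret group "galois_group \<iota>" by (rule group_galois_group)
  have "carrier (galois_group \<iota>) = (\<lambda>j. \<sigma> ^^ j) ` {..<N}"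
  proof
    have "\<tau> \<in> range (\<lambda>j. \<sigma> ^^ j)" if "\<tau> \<in> generate (galois_group \<iota>) {\<sigma>}" for \<tau>
      using that
    proof (induction rule: generate.induct)
      case one
      show ?case by (rule range_eqI[of _ _ 0]) (simp add: galois_group_def id_def)
    next
      case (incl h)
      then show ?case by (intro range_eqI[of _ _ 1]) simp
    next
      case (inv h)
      have pow_mem: "\<sigma> ^^ j \<in> carrier (galois_group \<iota>)" for j
        by (simp add: galois_group_def bij_sigma sigma_add sigma_mult sigma_embedding)
      \<comment> \<open>Finite order makes the inverse of \<sigma> a nonnegative power, so
        generation produces only such powers.\<close>
      have "\<sigma> ^^ (N - 1) \<otimes>\<^bsub>galois_group \<iota>\<^esub> \<sigma> = \<one>\<^bsub>galois_group \<iota>\<^esub>"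
        using N funpow_Suc_right[of "N - 1" \<sigma>]
        by (simp add: galois_group_def del: funpow.simps)
      then have "inv\<^bsub>galois_group \<iota>\<^esub> \<sigma> = \<sigma> ^^ (N - 1)"
        using inv_equality[OF _ sigma pow_mem] by blast
      then show ?case using inv by auto
    next
      case (eng h1 h2)
      then obtain i j where "h1 = \<sigma> ^^ i" "h2 = \<sigma> ^^ j" by auto
      then have "h1 \<otimes>\<^bsub>galois_group \<iota>\<^esub> h2 = \<sigma> ^^ (i + j)"
        by (simp add: galois_group_def funpow_add)
      then show ?case by auto
    qed
    then show "carrier (galois_group \<iota>) \<subseteq> (\<lambda>j. \<sigma> ^^ j) ` {..<N}"
      using generates reduce by blast
    show "(\<lambda>j. \<sigma> ^^ j) ` {..<N} \<subseteq> carrier (galois_group \<iota>)"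
      by (auto simp: galois_group_def bij_sigma sigma_add sigma_mult sigma_embedding)
  qed
  then have "\<iota> (ext_trace \<iota> x) = (\<Sum>j<N. (\<sigma> ^^ j) x)" for x
    using embed_ext_trace[OF galois] sum.reindex[OF distinct] by simp
  then show thesis
    using that[of N] N M \<open>N \<le> M\<close> by auto
qed

section \<open>Linearity, invariance and nondegeneracy of the trace\<close>

lemma trace_add: "ext_trace \<iota> (x + y) = ext_trace \<iota> x + ext_trace \<iota> y"
proof -
  obtain N where N: "\<And>x. \<iota> (ext_trace \<iota> x) = (\<Sum>j<N. (\<sigma> ^^ j) x)"
    using trace_as_power_sum by blast
  have "\<iota> (ext_trace \<iota> (x + y)) = \<iota> (ext_trace \<iota> x + ext_trace \<iota> y)"
    by (simp add: N embedding sigma_add sum.distrib)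
  then show ?thesis by (simp add: embedding_inj)
qed

lemma trace_scale: "ext_trace \<iota> (\<iota> c * x) = c * ext_trace \<iota> x"
proof -
  obtain N where N: "\<And>x. \<iota> (ext_trace \<iota> x) = (\<Sum>j<N. (\<sigma> ^^ j) x)"
    using trace_as_power_sum by blast
  have "\<iota> (ext_trace \<iota> (\<iota> c * x)) = \<iota> (c * ext_trace \<iota> x)"
    by (simp add: N embedding sigma_mult sigma_embedding sum_distrib_left)
  then show ?thesis by (simp add: embedding_inj)
qed

lemma trace_0: "ext_trace \<iota> 0 = 0"
  using trace_add[of 0 0] by (metis add_cancel_right_right)

lemma trace_diff: "ext_trace \<iota> (x - y) = ext_trace \<iota> x - ext_trace \<iota> y"
  using trace_add[of "x - y" y] by simp

lemma trace_sum: "ext_trace \<iota> (\<Sum>i\<in>I. f i) = (\<Sum>i\<in>I. ext_trace \<iota> (f i))"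
  by (induction I rule: infinite_finite_induct) (auto simp: trace_0 trace_add)

lemma trace_sigma: "ext_trace \<iota> ((\<sigma> ^^ j) x) = ext_trace \<iota> x"
proof (induction j)
  case (Suc j)
  obtain N where N: "\<sigma> ^^ N = id" "\<And>x. \<iota> (ext_trace \<iota> x) = (\<Sum>j<N. (\<sigma> ^^ j) x)"
    using trace_as_power_sum by blast
  have "ext_trace \<iota> (\<sigma> y) = ext_trace \<iota> y" for y
  proof -
    \<comment> \<open>Both traces, each completed by one term \<open>y\<close>, are the sum of
      \<sigma>^j y over j \<le> N, because \<sigma>^N = id.\<close>
    have "(\<Sum>j<N. (\<sigma> ^^ j) (\<sigma> y)) + y = (\<Sum>j<Suc N. (\<sigma> ^^ j) y)"
      unfolding sigma_Suc_inner by (subst sum.lessThan_Suc_shift) (simp add: add.commute)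
    also have "\<dots> = (\<Sum>j<N. (\<sigma> ^^ j) y) + y"
      using N(1) by simp
    finally have "\<iota> (ext_trace \<iota> (\<sigma> y)) = \<iota> (ext_trace \<iota> y)"
      by (simp add: N(2))
    then show ?thesis by (simp add: embedding_inj)
  qed
  then show ?case using Suc by simp
qed simp

text \<open>For \<open>x \<noteq> 0\<close> the products \<open>x * y\<close> fill L, so the trace
  would vanish identically. It is the polynomial 1 + \<sigma> + ... + \<sigma>^(N-1) of degree below
  n, contradicting independence.\<close>

lemma trace_nondegenerate:
  assumes "\<And>y. ext_trace \<iota> (x * y) = 0"
  shows "x = 0"
proof (rule ccontr)
  assume x: "x \<noteq> 0"
  obtain N where N: "0 < N" "N \<le> card E" "\<And>x. \<iota> (ext_trace \<iota> x) = (\<Sum>j<N. (\<sigma> ^^ j) x)"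
    using trace_as_power_sum by blast
  have "(\<Sum>j\<le>N - 1. 1 * (\<sigma> ^^ j) z) = 0" for z
  proof -
    have "{..N - 1} = {..<N}" using N by auto
    then show ?thesis
      using assms[of "z / x"] x N(3)[of z] by (simp add: embedding_0)
  qed
  moreover have "N - 1 < card E" using N by linarith
  ultimately show False using coeffs_eq_0[of "\<lambda>_. 1" "N - 1" 0] by simp
qed

section \<open>The radical of a sum of trace forms\<close>

definition sum_form :: "nat \<Rightarrow> (nat \<Rightarrow> 'l) \<Rightarrow> 'l \<Rightarrow> 'l \<Rightarrow> 'k" where
  "sum_form k b = (\<Sum>i=1..k. trace_form \<iota> (b i) (\<sigma> ^^ i))"

lemma sum_form_apply:
  "sum_form k b x y = ext_trace \<iota> (\<Sum>i=1..k. b i * (x * (\<sigma> ^^ i) y - (\<sigma> ^^ i) x * y))"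
  by (simp add: sum_form_def sum_fun_apply2 trace_form_def trace_sum)

definition radical_coeff :: "nat \<Rightarrow> (nat \<Rightarrow> 'l) \<Rightarrow> nat \<Rightarrow> 'l" where
  "radical_coeff k b j =
    (if j < k then (\<sigma> ^^ j) (b (k - j)) else if j = k then 0 else - (\<sigma> ^^ k) (b (j - k)))"

text \<open>Applying \<open>\<sigma>\<^sup>k\<^sup>-\<^sup>i\<close> and \<open>\<sigma>\<^sup>k\<close> to the two halves of the \<open>i\<close>-th term under the
  trace turns the second argument into \<open>\<sigma>\<^sup>k y\<close> throughout.\<close>

lemma sum_form_eq_trace:
  "sum_form k b x y =
    ext_trace \<iota> ((\<Sum>j\<le>2 * k. radical_coeff k b j * (\<sigma> ^^ j) x) * (\<sigma> ^^ k) y)"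
proof -
  have "(\<Sum>j\<le>2 * k. radical_coeff k b j * (\<sigma> ^^ j) x) =
      (\<Sum>i=1..k. (\<sigma> ^^ (k - i)) (b i) * (\<sigma> ^^ (k - i)) x - (\<sigma> ^^ k) (b i) * (\<sigma> ^^ (k + i)) x)"
    unfolding sum_atMost_centered
    by (auto simp: radical_coeff_def intro!: sum.cong)
  then have "ext_trace \<iota> ((\<Sum>j\<le>2 * k. radical_coeff k b j * (\<sigma> ^^ j) x) * (\<sigma> ^^ k) y) =
      (\<Sum>i=1..k. ext_trace \<iota> ((\<sigma> ^^ (k - i)) (b i) * (\<sigma> ^^ (k - i)) x * (\<sigma> ^^ k) y) -
        ext_trace \<iota> ((\<sigma> ^^ k) (b i) * (\<sigma> ^^ (k + i)) x * (\<sigma> ^^ k) y))"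
    by (simp add: sum_distrib_right left_diff_distrib trace_sum trace_diff)
  also have "\<dots> = (\<Sum>i=1..k. ext_trace \<iota> (b i * x * (\<sigma> ^^ i) y) -
        ext_trace \<iota> (b i * (\<sigma> ^^ i) x * y))"
  proof (intro sum.cong refl arg_cong2[where f = "(-)"])
    fix i assume "i \<in> {1..k}"
    then have "(\<sigma> ^^ k) y = (\<sigma> ^^ (k - i)) ((\<sigma> ^^ i) y)"
      by (simp add: sigma_compose)
    then show "ext_trace \<iota> ((\<sigma> ^^ (k - i)) (b i) * (\<sigma> ^^ (k - i)) x * (\<sigma> ^^ k) y) =
        ext_trace \<iota> (b i * x * (\<sigma> ^^ i) y)"
      by (simp add: trace_sigma flip: sigma_mult)
    show "ext_trace \<iota> ((\<sigma> ^^ k) (b i) * (\<sigma> ^^ (k + i)) x * (\<sigma> ^^ k) y) =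
        ext_trace \<iota> (b i * (\<sigma> ^^ i) x * y)"
      by (simp add: funpow_add trace_sigma flip: sigma_mult)
  qed
  also have "\<dots> = sum_form k b x y"
    by (simp add: sum_form_apply trace_sum trace_diff right_diff_distrib mult.assoc)
  finally show ?thesis ..
qed

text \<open>As \<sigma>^k is onto, the second factor under the trace runs through L, and
  nondegeneracy forces the first factor to vanish.\<close>

lemma radical_sum_form:
  "radical (sum_form k b) = {x. (\<Sum>j\<le>2 * k. radical_coeff k b j * (\<sigma> ^^ j) x) = 0}"
proof -
  have "P = 0" if "\<forall>y. ext_trace \<iota> (P * (\<sigma> ^^ k) y) = 0" for P
  proof (rule trace_nondegenerate)
    fix z
    obtain y where "z = (\<sigma> ^^ k) y"
      using bij_sigma[of k] by (metis bij_pointE)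
    then show "ext_trace \<iota> (P * z) = 0" using that by simp
  qed
  then show ?thesis
    by (auto simp: radical_def sum_form_eq_trace trace_0)
qed

lemma dim_radical_sum_form_le:
  assumes "i \<in> {1..k}" "b i \<noteq> 0"
  shows "V.dim (radical (sum_form k b)) \<le> 2 * k"
  unfolding radical_sum_form
proof (rule dim_roots_le)
  show "\<exists>j\<le>2 * k. radical_coeff k b j \<noteq> 0"
    \<comment> \<open>The coefficient at \<open>k - i\<close> is \<sigma>^(k-i) (b i).\<close>
    using assms by (intro exI[of _ "k - i"]) (auto simp: radical_coeff_def sigma_eq_0_iff)
qed

text \<open>The zero form has radical L, of dimension n > 2k, too large for a nonzero parameter.
  Directness and the dimension count both rest on this.\<close>

lemma sum_form_eq_0D:
  assumes "sum_form k b = 0" "2 * k < card E" "i \<in> {1..k}"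
  shows "b i = 0"
proof (rule ccontr)
  assume "b i \<noteq> 0"
  moreover have "radical (sum_form k b) = UNIV"
    using assms by (simp add: radical_def)
  ultimately show False
    using dim_radical_sum_form_le[of i k b] assms by simp
qed

section \<open>The sum of the spaces of trace forms: directness and dimension\<close>

lemma trace_form_add: "trace_form \<iota> (b + c) \<tau> = trace_form \<iota> b \<tau> + trace_form \<iota> c \<tau>"
  by (simp add: trace_form_def fun_eq_iff distrib_right trace_add)

lemma trace_form_scale: "trace_form \<iota> (ext_scale \<iota> c b) \<tau> = form_scale c (trace_form \<iota> b \<tau>)"
  by (simp add: trace_form_def form_scale_def fun_eq_iff ext_scale_def mult.assoc trace_scale)

lemma trace_form_0: "trace_form \<iota> 0 \<tau> = 0"
  by (simp add: trace_form_def fun_eq_iff trace_0)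

lemma trace_form_sum: "trace_form \<iota> (\<Sum>i\<in>I. f i) \<tau> = (\<Sum>i\<in>I. trace_form \<iota> (f i) \<tau>)"
  by (induction I rule: infinite_finite_induct) (auto simp: trace_form_0 trace_form_add)

lemma trace_forms_choice:
  assumes "\<forall>i\<in>I. s i \<in> trace_forms \<iota> (\<tau> i)"
  obtains b where "\<forall>i\<in>I. s i = trace_form \<iota> (b i) (\<tau> i)"
proof -
  have "\<forall>i\<in>I. \<exists>b. s i = trace_form \<iota> b (\<tau> i)"
    using assms by (auto simp: trace_forms_def)
  from bchoice[OF this] show thesis
    using that by blast
qed

lemma sum_trace_forms:
  "(\<Sum>i=1..k. trace_forms \<iota> (\<sigma> ^^ i)) = range (sum_form k)"
proof -
  have "(\<Sum>i=1..k. s i) \<in> range (sum_form k)"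
    if s: "\<forall>i\<in>{1..k}. s i \<in> trace_forms \<iota> (\<sigma> ^^ i)" for s
  proof -
    obtain b where "\<forall>i\<in>{1..k}. s i = trace_form \<iota> (b i) (\<sigma> ^^ i)"
      using s by (rule trace_forms_choice)
    then show ?thesis by (auto simp: sum_form_def intro!: range_eqI[of _ _ b])
  qed
  moreover have "sum_form k b \<in>
      {sum s {1..k} |s. \<forall>i\<in>{1..k}. s i \<in> trace_forms \<iota> (\<sigma> ^^ i)}" for b
    unfolding sum_form_def trace_forms_def
    by (intro CollectI exI[of _ "\<lambda>i. trace_form \<iota> (b i) (\<sigma> ^^ i)"]) auto
  ultimately show ?thesis
    by (auto simp: set_sum_alt)
qed

lemma subspace_trace_forms: "module.subspace form_scale (trace_forms \<iota> \<tau>)"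
proof -
  interpret F: vector_space "form_scale :: 'k \<Rightarrow> ('l \<Rightarrow> 'l \<Rightarrow> 'k) \<Rightarrow> _"
    by (rule vector_space_form_scale)
  show ?thesis
    unfolding F.subspace_def trace_forms_def
    using trace_form_0[of \<tau>]
    by (auto simp flip: trace_form_add trace_form_scale intro: range_eqI[of _ _ 0])
qed

lemma subspace_sum_forms: "module.subspace form_scale (range (sum_form k))"
proof -
  interpret F: vector_space "form_scale :: 'k \<Rightarrow> ('l \<Rightarrow> 'l \<Rightarrow> 'k) \<Rightarrow> _"
    by (rule vector_space_form_scale)
  have "0 = sum_form k (\<lambda>_. 0)"
    "sum_form k b + sum_form k c = sum_form k (\<lambda>i. b i + c i)"
    "form_scale r (sum_form k b) = sum_form k (\<lambda>i. ext_scale \<iota> r (b i))" for b c r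
    by (simp_all add: sum_form_def trace_form_0 trace_form_add trace_form_scale sum.distrib
        F.scale_sum_right)
  then show ?thesis
    unfolding F.subspace_def by auto
qed

lemma sum_form_in_Alt: "sum_form k b \<in> Alt \<iota>"
proof -
  have "vector_space ((*) :: 'k \<Rightarrow> 'k \<Rightarrow> 'k)"
    by unfold_locales (auto simp: algebra_simps)
  moreover have "sum_form k b (x + x') y = sum_form k b x y + sum_form k b x' y"
    "sum_form k b x (y + y') = sum_form k b x y + sum_form k b x y'" for x x' y y'
    by (simp_all add: sum_form_apply sigma_add flip: trace_add sum.distrib)
       (simp_all add: algebra_simps)
  moreover have "sum_form k b (ext_scale \<iota> c x) y = c * sum_form k b x y"
    "sum_form k b x (ext_scale \<iota> c y) = c * sum_form k b x y" for x y c
    by (simp_all add: sum_form_apply ext_scale_def sigma_mult sigma_embedding sum_distrib_left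
        flip: trace_scale) (simp_all add: algebra_simps)
  moreover have "sum_form k b x x = 0" for x
    by (simp add: sum_form_apply mult.commute trace_0)
  ultimately show ?thesis
    by (simp add: Alt_def Vector_Spaces.linear_iff V.vector_space_axioms)
qed

lemma direct_family_trace_forms:
  assumes k: "2 * k < card E"
    and A: "\<And>i. i \<in> {1..k} \<Longrightarrow> A i = trace_forms \<iota> (\<sigma> ^^ i)"
  shows "direct_family {1..k} A"
  unfolding direct_family_def
proof (intro conjI ballI allI impI)
  fix i assume "i \<in> {1..k}"
  then show "module.subspace form_scale (A i)"
    by (simp only: A subspace_trace_forms)
next
  fix g i assume g: "(\<forall>i\<in>{1..k}. g i \<in> A i) \<and> (\<Sum>i=1..k. g i) = 0"
    and i: "i \<in> {1..k}"
  have "\<forall>i\<in>{1..k}. g i \<in> trace_forms \<iota> (\<sigma> ^^ i)"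
    using g A by blast
  then obtain b where b: "\<forall>i\<in>{1..k}. g i = trace_form \<iota> (b i) (\<sigma> ^^ i)"
    by (rule trace_forms_choice)
  then have "sum_form k b = 0" using g by (simp add: sum_form_def)
  then have "b i = 0" using k i by (rule sum_form_eq_0D)
  then show "g i = 0" using b i by (simp add: trace_form_0)
qed

text \<open>The forms with parameter \<open>e \<in> E\<close> and automorphism \<sigma>^i, 1 \<le> i
  \<le> k, make up a basis.\<close>

lemma dim_sum_forms:
  assumes k: "2 * k < card E"
  shows "vector_space.dim form_scale (range (sum_form k)) = card E * k"
proof -
  interpret F: vector_space "form_scale :: 'k \<Rightarrow> ('l \<Rightarrow> 'l \<Rightarrow> 'k) \<Rightarrow> _"
    by (rule vector_space_form_scale)
  define t where "t = (\<lambda>(i, e). trace_form \<iota> e (\<sigma> ^^ i))"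
  let ?I = "{1..k} \<times> E"
  have sum_single: "sum_form k (\<lambda>j. if j = i then e else 0) = trace_form \<iota> e (\<sigma> ^^ i)"
    if "i \<in> {1..k}" for i e
  proof -
    have "sum_form k (\<lambda>j. if j = i then e else 0) =
        (\<Sum>j=1..k. if j = i then trace_form \<iota> e (\<sigma> ^^ i) else 0)"
      unfolding sum_form_def by (intro sum.cong) (auto simp: trace_form_0)
    then show ?thesis using that by simp
  qed
  \<comment> \<open>Independence is shown for the indexed family first, since injectivity of
    \<open>t\<close> is derived from it. Collecting the terms with equal \<open>i\<close> gives the
    parameter b i = \<Sum> u(i, e) e, which must be 0.\<close>
  have indep: "u p = 0" if u: "(\<Sum>p\<in>?I. form_scale (u p) (t p)) = 0" and p: "p \<in> ?I" for u p
  proof -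
    have "0 = (\<Sum>i=1..k. \<Sum>e\<in>E. form_scale (u (i, e)) (t (i, e)))"
      using u by (simp add: sum.cartesian_product)
    also have "\<dots> = sum_form k (\<lambda>i. \<Sum>e\<in>E. ext_scale \<iota> (u (i, e)) e)"
      by (simp add: sum_form_def t_def trace_form_sum trace_form_scale)
    finally have "(\<Sum>e\<in>E. ext_scale \<iota> (u (fst p, e)) e) = 0"
      using sum_form_eq_0D[OF sym k, of "\<lambda>i. \<Sum>e\<in>E. ext_scale \<iota> (u (i, e)) e" "fst p"] p by auto
    then show ?thesis
      using V.independent_Basis p V.independent_explicit[of E] by (cases p) force
  qed
  have inj: "inj_on t ?I"
  proof (rule inj_onI, rule ccontr)
    fix p q assume pq: "p \<in> ?I" "q \<in> ?I" "t p = t q" "p \<noteq> q"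
    \<comment> \<open>A coincidence \<open>t p = t q\<close> would be a relation with coefficients 1
      and -1.\<close>
    let ?u = "\<lambda>r. if r = p then 1 else if r = q then -1 else (0 :: 'k)"
    have "(\<Sum>r\<in>?I. form_scale (?u r) (t r)) = (\<Sum>r\<in>{p, q}. form_scale (?u r) (t r))"
      using pq V.finite_Basis by (intro sum.mono_neutral_right) auto
    also have "\<dots> = 0" using pq by simp
    finally show False using indep[of ?u p] pq by simp
  qed
  have "F.independent (t ` ?I)"
  proof (rule F.independent_if_scalars_zero)
    show "finite (t ` ?I)" using V.finite_Basis by simp
    fix u f assume "(\<Sum>f\<in>t ` ?I. form_scale (u f) f) = 0" and f: "f \<in> t ` ?I"
    then have "(\<Sum>p\<in>?I. form_scale ((u \<circ> t) p) (t p)) = 0"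
      by (simp only: sum.reindex[OF inj] o_def)
    then have "\<forall>p\<in>?I. (u \<circ> t) p = 0"
      using indep by blast
    then show "u f = 0"
      using f by auto
  qed
  moreover have "t ` ?I \<subseteq> range (sum_form k)"
    by (auto simp: t_def simp flip: sum_single)
  moreover have "range (sum_form k) \<subseteq> F.span (t ` ?I)"
  proof -
    have "trace_form \<iota> b (\<sigma> ^^ i) \<in> F.span (t ` ?I)" if i: "i \<in> {1..k}" for b i
    proof -
      have "b \<in> V.span E" by (simp add: V.span_Basis)
      then show ?thesis
      proof (induction rule: V.span_induct)
        case base
        show ?case
          by (simp add: V.subspace_def trace_form_0 trace_form_add trace_form_scale
              F.span_zero F.span_add F.span_scale)
      next
        case (step e)
        then have "t (i, e) \<in> F.span (t ` ?I)" using i by (intro F.span_base) blast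
        then show ?case by (simp only: t_def prod.case)
      qed
    qed
    then show ?thesis
      unfolding sum_form_def by (intro image_subsetI F.span_sum)
  qed
  moreover have "card (t ` ?I) = card E * k"
    using card_image[OF inj] by (simp add: card_cartesian_product mult.commute)
  ultimately show ?thesis
    by (intro F.dim_unique)
qed

section \<open>The rank bound\<close>

lemma form_rank_sum_form_ge:
  assumes "sum_form k b \<noteq> 0" "2 * k < card E" "odd (card E)"
  shows "form_rank \<iota> (sum_form k b) \<ge> card E - 2 * k + 1"
proof -
  have "even (V.dim UNIV + V.dim {x \<in> UNIV. \<forall>y\<in>UNIV. sum_form k b x y = 0})"
    using sum_form_in_Alt[of k b] by (intro V.even_dim_plus_dim_radical) (auto simp: Alt_def)
  then have "odd (V.dim (radical (sum_form k b)))"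
    using assms by (simp add: radical_def)
  moreover obtain i where "i \<in> {1..k}" "b i \<noteq> 0"
    using assms(1) by (force simp: sum_form_def trace_form_0 intro: sum.neutral)
  then have "V.dim (radical (sum_form k b)) \<le> 2 * k"
    by (rule dim_radical_sum_form_le)
  \<comment> \<open>An odd dimension cannot equal \<open>2 * k\<close>; this strictness gives the
    extra 1 in the bound.\<close>
  ultimately have "V.dim (radical (sum_form k b)) < 2 * k"
    by (metis dvd_triv_left le_neq_implies_less)
  then show ?thesis
    using assms(2) by (simp add: form_rank_def extension_degree_def)
qed

end

theorem theorem6:
  fixes \<iota> :: "'k::field \<Rightarrow> 'l::field"
    and \<sigma> :: "'l \<Rightarrow> 'l"
    and n m k :: nat
    and A :: "nat \<Rightarrow> ('l \<Rightarrow> 'l \<Rightarrow> 'k) set"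
  assumes "galois_extension \<iota>"
    and "extension_degree \<iota> = n"
    and "n = 2 * m + 1"
    and "\<sigma> \<in> carrier (galois_group \<iota>)"
    and "generate (galois_group \<iota>) {\<sigma>} = carrier (galois_group \<iota>)"
    and "\<And>i. 1 \<le> i \<Longrightarrow> i \<le> m \<Longrightarrow> A i = trace_forms \<iota> (\<sigma> ^^ i)"
    and "1 \<le> k"
    and "k \<le> m"
  shows "direct_family {1..k} A
    \<and> (\<Sum>i=1..k. A i) \<subseteq> Alt \<iota>
    \<and> module.subspace form_scale (\<Sum>i=1..k. A i)
    \<and> vector_space.dim form_scale (\<Sum>i=1..k. A i) = n * k
    \<and> (\<forall>f\<in>(\<Sum>i=1..k. A i). f \<noteq> 0 \<longrightarrow> form_rank \<iota> f \<ge> n - 2 * k + 1)"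
proof -
  obtain E where "finite_dimensional_vector_space (ext_scale \<iota>) E"
    using assms(1) by (auto simp: galois_extension_def)
  then interpret cyclic_extension \<iota> E \<sigma>
    by (intro cyclic_extension.intro cyclic_extension_axioms.intro assms(1,4,5))
  have n: "n = card E"
    using assms(2) by (simp add: extension_degree_def)
  have k: "2 * k < card E" "odd (card E)"
    using assms n by auto
  have A: "A i = trace_forms \<iota> (\<sigma> ^^ i)" if "i \<in> {1..k}" for i
    using assms that by auto
  have sum: "(\<Sum>i=1..k. A i) = range (sum_form k)"
    unfolding sum_trace_forms[symmetric] by (rule sum.cong[OF refl A])
  show ?thesis
    unfolding sum n
  proof (intro conjI ballI impI)
    show "direct_family {1..k} A"
      by (rule direct_family_trace_forms[OF k(1) A])
    show "range (sum_form k) \<subseteq> Alt \<iota>"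
      by (rule image_subsetI) (rule sum_form_in_Alt)
    show "module.subspace form_scale (range (sum_form k))"
      by (rule subspace_sum_forms)
    show "vector_space.dim form_scale (range (sum_form k)) = card E * k"
      by (rule dim_sum_forms[OF k(1)])
    show "card E - 2 * k + 1 \<le> form_rank \<iota> f" if f: "f \<in> range (sum_form k)" "f \<noteq> 0" for f
      using f(1)
    proof (rule rangeE)
      fix b assume "f = sum_form k b"
      then show ?thesis using form_rank_sum_form_ge[OF _ k] f(2) by (simp only:)
    qed
  qed
qed

end
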